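(* Let $N\in\mathbb{N}$, let $B=\mathcal{C}^N$ be the $N$-th Toeplitz matricial algebra, let $(A,\varphi)$ be a noncommutative probability space, and let $(T,E)$ be the Toeplitz matricial probability space over $B$ induced by $(A,\varphi)$. Let $s\in\mathbb{N}$ and let $A_1=(a_1^{(1)},\dots,a_N^{(1)}),\dots,A_s=(a_1^{(s)},\dots,a_N^{(s)})\in T$. Then for all $n\in\mathbb{N}$ and all $(i_1,\dots,i_n)\in\{1,\dots,s\}^n$, the $(i_1,\dots,i_n)$-th $B$-valued cumulant of $A_1,\dots,A_s$ is $$K_n(A_{i_1},\dots,A_{i_n})=\bigl(k_n(Q_1^{(i_1,\dots,i_n)}),\dots,k_n(Q_N^{(i_1,\dots,i_n)})\bigr)\in B .$$
   Context: A noncommutative probability space $(A,\varphi)$ is a unital complex algebra $A$ with a linear functional $\varphi:A\to\mathbb{C}$ with $\varphi(1)=1$. $\mathcal{C}^N$ is $\mathbb{C}^N$ with componentwise addition and product whose $j$-th component is $\sum_{k=1}^{j}\alpha_k\alpha'_{j+1-k}$ for $j=1,\dots,N$ (i.e. upper triangular Toeplitz matrices with first row $(\alpha_1,\dots,\alpha_N)$); its unit is $(1,0,\dots,0)$. The Toeplitz matricial probability space $(T,E)$ over $B=\mathcal{C}^N$ induced by $(A,\varphi)$ consists of $T=\{(a_1,\dots,a_N):a_j\in A\}$ with componentwise addition and product whose $j$-th component is $\sum_{k=1}^{j}a_ka'_{j+1-k}$, containing $B$ via $\mathbb{C}=\mathbb{C}1_A\subset A$, and of $E:T\to B$, $E((a_1,\dots,a_N))=(\varphi(a_1),\dots,\varphi(a_N))$.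 $B$ is central in $T$. $NC(n)$ is the lattice of noncrossing partitions of $\{1,\dots,n\}$ ordered by refinement, with maximum $1_n$ and Möbius function $\mu$. Scalar cumulants: $k_n(x_1,\dots,x_n)=\sum_{\pi\in NC(n)}\bigl(\prod_{V\in\pi}\varphi(\prod_{v\in V}x_v)\bigr)\mu(\pi,1_n)$ for $x_i\in A$. $B$-valued cumulants: $K_n(X_1,\dots,X_n)=\sum_{\pi\in NC(n)}\bigl(\prod_{V\in\pi}E(\prod_{v\in V}X_v)\bigr)\mu(\pi,1_n)$ for $X_i\in T$. Products inside $\varphi$ and $E$ are taken in increasing order of indices. The $Q_j^{(i_1,\dots,i_n)}$ ($j=1,\dots,N$) are formal sums of $n$-tuples of elements of $A$, defined inductively by $Q_j^{(i_1)}=a_j^{(i_1)}$ and $Q_j^{(i_1,\dots,i_n)}=\sum_{k=1}^{j}\bigl(Q_k^{(i_1,\dots,i_{n-1})},a_{j+1-k}^{(i_n)}\bigr)$, where $(\,\cdot\,,a)$ means appending $a$ to every tuple of the formal sum. The addition is purely formal (not pointwise), and $k_n$ of a formal sum of $n$-tuples is the sum of the values of $k_n$ on those tuples. *)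

theory Defs
  imports
    Complex_Main
    "HOL-Library.Disjoint_Sets"
    "HOL-Library.FuncSet"
    "HOL-Library.Multiset"
    "HOL-Library.Cardinality"
begin

section \<open>Noncommutative probability spaces\<close>

text \<open>
  The unital complex algebra is a type of class \<open>ring_1\<close> together with a complex scalar
  multiplication. Nontriviality of the ring, which is part of the class \<open>ring_1\<close>, is no restriction:
  it follows from \<open>\<phi> 1 = 1\<close> and \<open>\<phi> 0 = 0\<close>.
\<close>

locale nc_prob_space = Vector_Spaces.linear scale "(*)" \<phi>
  for scale :: "complex \<Rightarrow> 'a::ring_1 \<Rightarrow> 'a" (infixr \<open>*\<^sub>C\<close> 75) and \<phi> :: "'a \<Rightarrow> complex" +
  assumes scale_mult_left: "(c *\<^sub>C x) * y = c *\<^sub>C (x * y)"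
    and scale_mult_right: "x * (c *\<^sub>C y) = c *\<^sub>C (x * y)"
    and unital: "\<phi> 1 = 1"


section \<open>Toeplitz tuples\<close>

text \<open>
  The type \<open>('a, 'n) toeplitz\<close> consists of the tuples \<open>(a\<^sub>1, \<dots>, a\<^sub>N)\<close> over \<open>'a\<close>, where \<open>N = CARD('n)\<close>;
  only the cardinality of the finite index type \<open>'n\<close> plays a role. A tuple is represented by a
  function on the natural numbers that vanishes off \<open>{1..N}\<close>. Thus \<open>(complex, 'n) toeplitz\<close> is the
  Toeplitz matricial algebra, and \<open>('a, 'n) toeplitz\<close> is the algebra of the Toeplitz matricial
  probability space induced by a noncommutative probability space on \<open>'a\<close>.
\<close>

typedef (overloaded) ('a::zero, 'n::finite) toeplitz =
  "{a :: nat \<Rightarrow> 'a. \<forall>j. j \<notin> {1..CARD('n)} \<longrightarrow> a j = 0}"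
  morphisms entry Abs_toeplitz
  by (rule exI[of _ "\<lambda>_. 0"]) simp

setup_lifting type_definition_toeplitz

lift_definition tuple :: "(nat \<Rightarrow> 'a::zero) \<Rightarrow> ('a, 'n::finite) toeplitz"
  is "\<lambda>a j. if j \<in> {1..CARD('n)} then a j else 0"
  by auto

lemma entry_tuple:
  "entry (tuple a :: ('a::zero, 'n::finite) toeplitz) j = (if j \<in> {1..CARD('n)} then a j else 0)"
  by transfer simp

lemma entry_outside: "j \<notin> {1..CARD('n)} \<Longrightarrow> entry (X :: ('a::zero, 'n::finite) toeplitz) j = 0"
  by transfer blast

lemma toeplitz_eqI:
  fixes X Y :: "('a::zero, 'n::finite) toeplitz"
  assumes "\<And>j. j \<in> {1..CARD('n)} \<Longrightarrow> entry X j = entry Y j"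
  shows "X = Y"
  using assms entry_outside[of _ X] entry_outside[of _ Y]
  by (metis (no_types, lifting) entry_inject ext)

instantiation toeplitz :: (ring_1, finite) ring_1
begin

definition zero_toeplitz :: "('a, 'b) toeplitz" where
  "0 = tuple (\<lambda>j. 0)"

definition one_toeplitz :: "('a, 'b) toeplitz" where
  "1 = tuple (\<lambda>j. if j = 1 then 1 else 0)"

definition plus_toeplitz :: "('a, 'b) toeplitz \<Rightarrow> ('a, 'b) toeplitz \<Rightarrow> ('a, 'b) toeplitz" where
  "X + Y = tuple (\<lambda>j. entry X j + entry Y j)"

definition uminus_toeplitz :: "('a, 'b) toeplitz \<Rightarrow> ('a, 'b) toeplitz" where
  "- X = tuple (\<lambda>j. - entry X j)"

definition minus_toeplitz :: "('a, 'b) toeplitz \<Rightarrow> ('a, 'b) toeplitz \<Rightarrow> ('a, 'b) toeplitz" where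
  "X - Y = tuple (\<lambda>j. entry X j - entry Y j)"

definition times_toeplitz :: "('a, 'b) toeplitz \<Rightarrow> ('a, 'b) toeplitz \<Rightarrow> ('a, 'b) toeplitz" where
  "X * Y = tuple (\<lambda>j. \<Sum>k=1..j. entry X k * entry Y (j + 1 - k))"

lemma entry_zero: "entry (0 :: ('a, 'b) toeplitz) j = 0"
  by (simp add: zero_toeplitz_def entry_tuple)

lemma entry_one: "entry (1 :: ('a, 'b) toeplitz) j = (if j = 1 then 1 else 0)"
  by (auto simp: one_toeplitz_def entry_tuple Suc_le_eq card_gt_0_iff)

lemma entry_plus: "entry (X + Y :: ('a, 'b) toeplitz) j = entry X j + entry Y j"
  by (simp add: plus_toeplitz_def entry_tuple entry_outside)

lemma entry_uminus: "entry (- X :: ('a, 'b) toeplitz) j = - entry X j"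
  by (simp add: uminus_toeplitz_def entry_tuple entry_outside)

lemma entry_minus: "entry (X - Y :: ('a, 'b) toeplitz) j = entry X j - entry Y j"
  by (simp add: minus_toeplitz_def entry_tuple entry_outside)

lemma entry_times:
  "entry (X * Y :: ('a, 'b) toeplitz) j
    = (if j \<in> {1..CARD('b)} then \<Sum>k=1..j. entry X k * entry Y (j + 1 - k) else 0)"
  by (simp add: times_toeplitz_def entry_tuple)

instance
proof
  fix X Y Z :: "('a, 'b) toeplitz"
  show "X * Y * Z = X * (Y * Z)"
  proof (rule toeplitz_eqI)
    fix j assume j: "j \<in> {1..CARD('b)}"
    have "entry (X * Y * Z) j
        = (\<Sum>k=1..j. (\<Sum>l=1..k. entry X l * entry Y (k + 1 - l)) * entry Z (j + 1 - k))"
      using j by (simp add: entry_times)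
    also have "\<dots> = (\<Sum>k=1..j. \<Sum>l=1..k. entry X l * entry Y (k + 1 - l) * entry Z (j + 1 - k))"
      by (simp add: sum_distrib_right)
    also have "\<dots> = (\<Sum>l=1..j. \<Sum>k=l..j. entry X l * entry Y (k + 1 - l) * entry Z (j + 1 - k))"
      by (simp add: sum.Sigma) (rule sum.reindex_bij_witness
          [of _ "\<lambda>(a, b). (b, a)" "\<lambda>(a, b). (b, a)"]; auto)
    also have "\<dots> = (\<Sum>l=1..j. \<Sum>m=1..j + 1 - l.
        entry X l * (entry Y m * entry Z (j + 1 - l + 1 - m)))"
    proof (rule sum.cong[OF refl])
      fix l assume "l \<in> {1..j}"
      then show "(\<Sum>k=l..j. entry X l * entry Y (k + 1 - l) * entry Z (j + 1 - k))
          = (\<Sum>m=1..j + 1 - l. entry X l * (entry Y m * entry Z (j + 1 - l + 1 - m)))"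
        by (intro sum.reindex_bij_witness[of _ "\<lambda>m. m + l - 1" "\<lambda>k. k + 1 - l"])
          (auto simp: mult.assoc)
    qed
    also have "\<dots> = entry (X * (Y * Z)) j"
      using j by (auto simp: entry_times sum_distrib_left intro!: sum.cong)
    finally show "entry (X * Y * Z) j = entry (X * (Y * Z)) j" .
  qed
  show "1 * X = X"
  proof (rule toeplitz_eqI)
    fix j assume j: "j \<in> {1..CARD('b)}"
    have "(\<Sum>k=1..j. entry (1 :: ('a, 'b) toeplitz) k * entry X (j + 1 - k))
        = (\<Sum>k=1..j. if k = 1 then entry X j else 0)"
      by (rule sum.cong) (auto simp: entry_one)
    then show "entry (1 * X) j = entry X j"
      using j by (simp add: entry_times)
  qed
  show "X * 1 = X"
  proof (rule toeplitz_eqI)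
    fix j assume j: "j \<in> {1..CARD('b)}"
    have "(\<Sum>k=1..j. entry X k * entry (1 :: ('a, 'b) toeplitz) (j + 1 - k))
        = (\<Sum>k=1..j. if k = j then entry X j else 0)"
      by (rule sum.cong) (auto simp: entry_one)
    then show "entry (X * 1) j = entry X j"
      using j by (simp add: entry_times)
  qed
  show "(X + Y) * Z = X * Z + Y * Z"
    by (rule toeplitz_eqI) (simp add: entry_plus entry_times distrib_right sum.distrib)
  show "X * (Y + Z) = X * Y + X * Z"
    by (rule toeplitz_eqI) (simp add: entry_plus entry_times distrib_left sum.distrib)
  have "entry (0 :: ('a, 'b) toeplitz) 1 \<noteq> entry (1 :: ('a, 'b) toeplitz) 1"
    by (simp add: entry_zero entry_one)
  then show "(0 :: ('a, 'b) toeplitz) \<noteq> 1"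
    by metis
qed (rule toeplitz_eqI; simp add: entry_zero entry_plus entry_uminus entry_minus algebra_simps)+

end

instance toeplitz :: (comm_ring_1, finite) comm_ring_1
proof
  fix X Y :: "('a, 'b) toeplitz"
  show "X * Y = Y * X"
  proof (rule toeplitz_eqI)
    fix j assume j: "j \<in> {1..CARD('b)}"
    have "(\<Sum>k=1..j. entry X k * entry Y (j + 1 - k)) = (\<Sum>k=1..j. entry Y k * entry X (j + 1 - k))"
      by (rule sum.reindex_bij_witness[of _ "\<lambda>k. j + 1 - k" "\<lambda>k. j + 1 - k"])
        (auto simp: mult.commute)
    then show "entry (X * Y) j = entry (Y * X) j"
      using j by (simp add: entry_times)
  qed
qed (simp_all add: distrib_right)

definition toeplitz_expectation ::
    "('a::ring_1 \<Rightarrow> complex) \<Rightarrow> ('a, 'n::finite) toeplitz \<Rightarrow> (complex, 'n) toeplitz" where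
  "toeplitz_expectation \<phi> X = tuple (\<lambda>j. \<phi> (entry X j))"


section \<open>Noncrossing partitions\<close>

definition noncrossing :: "nat set set \<Rightarrow> bool" where
  "noncrossing \<pi> \<longleftrightarrow>
    \<not> (\<exists>V\<in>\<pi>. \<exists>W\<in>\<pi>. V \<noteq> W \<and>
        (\<exists>a\<in>V. \<exists>b\<in>W. \<exists>c\<in>V. \<exists>d\<in>W. a < b \<and> b < c \<and> c < d))"

definition NC :: "nat \<Rightarrow> nat set set set" where
  "NC n = {\<pi>. partition_on {1..n} \<pi> \<and> noncrossing \<pi>}"

lemma finite_NC: "finite (NC n)"
  by (rule finite_subset[OF _ finitely_many_partition_on[of "{1..n}"]]) (auto simp: NC_def)

text \<open>
  The Moebius function of the lattice \<open>NC n\<close> ordered by refinement, given by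
  \<open>\<mu>(\<pi>, \<pi>) = 1\<close> and \<open>\<Sum>\<^bsub>\<pi> \<le> \<tau> \<le> \<sigma>\<^esub> \<mu>(\<pi>, \<tau>) = 0\<close> for \<open>\<pi> < \<sigma>\<close>.
\<close>

function moebius_NC :: "nat \<Rightarrow> nat set set \<Rightarrow> nat set set \<Rightarrow> int" where
  "moebius_NC n \<pi> \<sigma> =
    (if \<pi> \<notin> NC n \<or> \<sigma> \<notin> NC n \<or> \<not> refines {1..n} \<pi> \<sigma> then 0
     else if \<pi> = \<sigma> then 1
     else - (\<Sum>\<tau>\<in>{\<tau>\<in>NC n. refines {1..n} \<pi> \<tau> \<and> refines {1..n} \<tau> \<sigma> \<and> \<tau> \<noteq> \<sigma>}. moebius_NC n \<pi> \<tau>))"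
  by pat_completeness auto
termination
proof (relation "measure (\<lambda>(n, \<pi>, \<sigma>). card {\<rho>\<in>NC n. refines {1..n} \<rho> \<sigma>})", goal_cases)
  case (2 n \<pi> \<sigma> \<tau>)
  have "{\<rho>\<in>NC n. refines {1..n} \<rho> \<tau>} \<subset> {\<rho>\<in>NC n. refines {1..n} \<rho> \<sigma>}"
  proof
    show "{\<rho>\<in>NC n. refines {1..n} \<rho> \<tau>} \<subseteq> {\<rho>\<in>NC n. refines {1..n} \<rho> \<sigma>}"
      using 2 refines_trans by blast
    have "\<sigma> \<in> {\<rho>\<in>NC n. refines {1..n} \<rho> \<sigma>}"
      using 2 by (auto simp: NC_def intro: refines_refl)
    moreover have "\<sigma> \<notin> {\<rho>\<in>NC n. refines {1..n} \<rho> \<tau>}"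
      using 2 refines_asym by blast
    ultimately show "{\<rho>\<in>NC n. refines {1..n} \<rho> \<tau>} \<noteq> {\<rho>\<in>NC n. refines {1..n} \<rho> \<sigma>}"
      by blast
  qed
  then show ?case
    by (simp add: psubset_card_mono finite_NC)
qed simp

declare moebius_NC.simps [simp del]


section \<open>Cumulants\<close>

definition ordered_prod :: "'b::monoid_mult list \<Rightarrow> nat set \<Rightarrow> 'b" where
  "ordered_prod xs V = prod_list (map (\<lambda>v. xs ! (v - 1)) (sorted_list_of_set V))"

text \<open>
  The cumulant of the tuple \<open>xs = [x\<^sub>1, \<dots>, x\<^sub>n]\<close> with respect to \<open>F\<close>; both the scalar cumulants
  (\<open>F = \<phi>\<close>) and the Toeplitz-valued cumulants (\<open>F = toeplitz_expectation \<phi>\<close>) are of this form.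
  For \<open>n \<ge> 1\<close>, the partition \<open>{{1..n}}\<close> is the maximum of \<open>NC n\<close>.
\<close>

definition cumulant :: "('b::monoid_mult \<Rightarrow> 'c::comm_ring_1) \<Rightarrow> 'b list \<Rightarrow> 'c" where
  "cumulant F xs =
    (\<Sum>\<pi>\<in>NC (length xs). (\<Prod>V\<in>\<pi>. F (ordered_prod xs V)) *
      of_int (moebius_NC (length xs) \<pi> {{1..length xs}}))"

abbreviation scalar_cumulant :: "('a::ring_1 \<Rightarrow> complex) \<Rightarrow> 'a list \<Rightarrow> complex" where
  "scalar_cumulant \<phi> \<equiv> cumulant \<phi>"

abbreviation toeplitz_cumulant ::
    "('a::ring_1 \<Rightarrow> complex) \<Rightarrow> ('a, 'n::finite) toeplitz list \<Rightarrow> (complex, 'n) toeplitz" where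
  "toeplitz_cumulant \<phi> \<equiv> cumulant (toeplitz_expectation \<phi>)"

text \<open>
  A formal sum of tuples is a multiset of lists, so that formal addition is multiset union.
  \<open>Q A i n j\<close> is the formal sum with lower index \<open>j\<close> and upper index \<open>(i 1, \<dots>, i n)\<close>; the value at
  \<open>n = 0\<close> is a dummy.
\<close>

fun Q :: "(nat \<Rightarrow> ('a::zero, 'n::finite) toeplitz) \<Rightarrow> (nat \<Rightarrow> nat) \<Rightarrow> nat \<Rightarrow> nat \<Rightarrow> 'a list multiset" where
  "Q A i 0 j = {#}"
| "Q A i (Suc 0) j = {#[entry (A (i 1)) j]#}"
| "Q A i (Suc (Suc n)) j =
    (\<Sum>k=1..j. image_mset (\<lambda>t. t @ [entry (A (i (Suc (Suc n)))) (j + 1 - k)]) (Q A i (Suc n) k))"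

definition formal_cumulant :: "('a::ring_1 \<Rightarrow> complex) \<Rightarrow> 'a list multiset \<Rightarrow> complex" where
  "formal_cumulant \<phi> S = (\<Sum>t\<in>#S. scalar_cumulant \<phi> t)"

end

(* Writing T^d for the central tuple with a single entry 1 in position d + 1, every Toeplitz tuple
   is the sum of the products T^(j-1) * a_j with constant tuples a_j. The cumulants are multilinear
   over these central elements, so the B-valued cumulant of A_{i_1}, ..., A_{i_n} expands into
   cumulants of constant tuples, which are the scalar cumulants placed in the first entry. Collecting
   the coefficients of T^(j-1) reproduces the recursion defining Q_j. *)
theory Submission
  imports Defs
begin

section \<open>Toeplitz monomials: powers of the shift with coefficients\<close>

text \<open>Entries are numbered from 1, so degree \<open>d\<close> sits at index
  \<open>Suc d\<close>. Thus degree 0 embeds the coefficients as constant tuples, and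
  \<open>toeplitz_monom d 1\<close> is the \<open>d\<close>-th power of the nilpotent shift.\<close>

definition toeplitz_monom :: "nat \<Rightarrow> 'a::zero \<Rightarrow> ('a, 'n::finite) toeplitz" where
  "toeplitz_monom d a = tuple (\<lambda>j. if j = Suc d then a else 0)"

lemma entry_toeplitz_monom:
  "entry (toeplitz_monom d a :: ('a::zero, 'n::finite) toeplitz) j
    = (if j = Suc d \<and> d < CARD('n) then a else 0)"
  by (auto simp: toeplitz_monom_def entry_tuple)

lemma toeplitz_monom_eq_0:
  "CARD('n) \<le> d \<Longrightarrow> toeplitz_monom d a = (0 :: ('a::ring_1, 'n::finite) toeplitz)"
  by (rule toeplitz_eqI) (simp add: entry_toeplitz_monom entry_zero)

lemma toeplitz_monom_0_1: "toeplitz_monom 0 1 = (1 :: ('a::ring_1, 'n::finite) toeplitz)"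
  by (rule toeplitz_eqI) (simp add: entry_toeplitz_monom entry_one)

lemma toeplitz_monom_add:
  "toeplitz_monom d (a + b) = (toeplitz_monom d a + toeplitz_monom d b :: ('a::ring_1, 'n::finite) toeplitz)"
  by (rule toeplitz_eqI) (simp add: entry_toeplitz_monom entry_plus)

lemma entry_monom_times:
  fixes X :: "('a::ring_1, 'n::finite) toeplitz"
  shows "entry (toeplitz_monom d a * X) j
    = (if d < j \<and> j \<le> CARD('n) then a * entry X (j - d) else 0)"
proof (cases "j \<in> {1..CARD('n)}")
  case True
  have "(\<Sum>k=1..j. entry (toeplitz_monom d a :: ('a, 'n) toeplitz) k * entry X (j + 1 - k))
      = (\<Sum>k=1..j. if k = Suc d then a * entry X (j - d) else 0)"
    using True by (intro sum.cong) (auto simp: entry_toeplitz_monom)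
  with True show ?thesis
    by (auto simp: entry_times)
qed (auto simp: entry_outside)

lemma entry_times_monom:
  fixes X :: "('a::ring_1, 'n::finite) toeplitz"
  shows "entry (X * toeplitz_monom d a) j
    = (if d < j \<and> j \<le> CARD('n) then entry X (j - d) * a else 0)"
proof (cases "j \<in> {1..CARD('n)}")
  case True
  have "(\<Sum>k=1..j. entry X k * entry (toeplitz_monom d a :: ('a, 'n) toeplitz) (j + 1 - k))
      = (\<Sum>k=1..j. if k = j - d then (if d < j then entry X (j - d) * a else 0) else 0)"
    using True by (intro sum.cong) (auto simp: entry_toeplitz_monom)
  also have "\<dots> = (if d < j then entry X (j - d) * a else 0)"
    by (subst sum.delta) auto
  finally show ?thesis
    using True by (auto simp: entry_times)
qed (auto simp: entry_outside)

lemma toeplitz_monom_mult: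
  "toeplitz_monom d a * toeplitz_monom e b
    = (toeplitz_monom (d + e) (a * b) :: ('a::ring_1, 'n::finite) toeplitz)"
  by (rule toeplitz_eqI) (auto simp: entry_monom_times entry_toeplitz_monom)

text \<open>The coefficient 1 commutes with every entry, and shifting from the left or from the
  right moves entries alike; hence centrality holds over a noncommutative \<open>'a\<close> as
  well.\<close>

lemma toeplitz_monom_1_commute:
  "toeplitz_monom d 1 * X = X * (toeplitz_monom d 1 :: ('a::ring_1, 'n::finite) toeplitz)"
  by (rule toeplitz_eqI) (simp add: entry_monom_times entry_times_monom)

lemma entry_sum: "entry (sum f D :: ('a::ring_1, 'n::finite) toeplitz) j = (\<Sum>d\<in>D. entry (f d) j)"
  by (induction D rule: infinite_finite_induct) (simp_all add: entry_zero entry_plus)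

text \<open>Each summand is split into a central shift power and a constant tuple, the shape that
  multilinearity of cumulants consumes.\<close>

lemma toeplitz_eq_sum_monom:
  fixes X :: "('a::ring_1, 'n::finite) toeplitz"
  shows "X = (\<Sum>l=1..CARD('n). toeplitz_monom (l - 1) 1 * toeplitz_monom 0 (entry X l))"
proof (rule toeplitz_eqI)
  fix j assume j: "j \<in> {1..CARD('n)}"
  have "(\<Sum>l=1..CARD('n). entry (toeplitz_monom (l - 1) 1 * toeplitz_monom 0 (entry X l)
          :: ('a, 'n) toeplitz) j)
      = (\<Sum>l=1..CARD('n). if l = j then entry X j else 0)"
    by (rule sum.cong) (auto simp: entry_monom_times entry_toeplitz_monom)
  then show "entry X j
      = entry (\<Sum>l=1..CARD('n). toeplitz_monom (l - 1) 1 * toeplitz_monom 0 (entry X l)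
          :: ('a, 'n) toeplitz) j"
    using j by (simp add: entry_sum)
qed

lemma sum_monom_eq_tuple:
  fixes c :: "nat \<Rightarrow> 'a::ring_1"
  shows "(\<Sum>l=1..CARD('n). toeplitz_monom (l - 1) 1 * toeplitz_monom 0 (c l))
    = (tuple c :: ('a, 'n::finite) toeplitz)"
  by (subst (2) toeplitz_eq_sum_monom) (simp add: entry_tuple)


section \<open>Multilinearity of cumulants over central elements\<close>

text \<open>The sorted list of \<open>V\<close> is distinct, so it visits the position of
  \<open>x\<close> exactly once; the factors before and after it are chosen uniformly in
  \<open>x\<close>.\<close>

lemma ordered_prod_insert_position:
  assumes "finite V" "Suc (length xs) \<in> V" "0 \<notin> V"
  obtains u v :: "'b::monoid_mult"
  where "\<And>x. ordered_prod (xs @ x # ys) V = u * x * v"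
proof -
  let ?p = "Suc (length xs)"
  from assms obtain us vs where s: "sorted_list_of_set V = us @ ?p # vs"
    by (metis set_sorted_list_of_set split_list)
  have d: "distinct (us @ ?p # vs)"
    using distinct_sorted_list_of_set[of V] s by simp
  have S: "set (us @ ?p # vs) = V"
    using assms(1) s by (metis set_sorted_list_of_set)
  have nth: "(xs @ x # ys) ! (w - 1) = (xs @ y # ys) ! (w - 1)"
    if "w \<in> set us \<union> set vs" for w x y
  proof -
    \<comment> \<open>Positions start at 1 while \<open>!\<close> starts at 0. Since
      \<open>w - 1\<close> truncates, \<open>w = 0\<close> would read the same list element as
      position 1.\<close>
    have "w \<noteq> ?p" "w \<noteq> 0"
      using that d S assms(3) by auto
    then show ?thesis
      by (cases w) (auto simp: nth_append nth_Cons split: nat.split)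
  qed
  \<comment> \<open>The inserted 1 is a placeholder: neither \<open>us\<close> nor \<open>vs\<close>
    contains \<open>?p\<close>.\<close>
  define u where "u = prod_list (map (\<lambda>w. (xs @ 1 # ys) ! (w - 1)) us)"
  define v where "v = prod_list (map (\<lambda>w. (xs @ 1 # ys) ! (w - 1)) vs)"
  have "ordered_prod (xs @ x # ys) V = u * x * v" for x
  proof -
    have "map (\<lambda>w. (xs @ x # ys) ! (w - 1)) us = map (\<lambda>w. (xs @ 1 # ys) ! (w - 1)) us"
      "map (\<lambda>w. (xs @ x # ys) ! (w - 1)) vs = map (\<lambda>w. (xs @ 1 # ys) ! (w - 1)) vs"
      using nth by auto
    moreover have "(xs @ x # ys) ! (?p - 1) = x"
      by simp
    ultimately show ?thesis
      unfolding ordered_prod_def s u_def v_def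
      by (simp only: list.map map_append prod_list.append prod_list.Cons mult.assoc)
  qed
  then show ?thesis
    using that by blast
qed

lemma ordered_prod_other_position:
  assumes "finite V" "Suc (length xs) \<notin> V" "0 \<notin> V"
  shows "ordered_prod (xs @ x # ys) V = ordered_prod (xs @ y # ys) V"
proof -
  have "(xs @ x # ys) ! (w - 1) = (xs @ y # ys) ! (w - 1)" if "w \<in> V" for w
  proof -
    have "w \<noteq> Suc (length xs)" "w \<noteq> 0"
      using that assms(2,3) by metis+
    then show ?thesis
      by (cases w) (auto simp: nth_append nth_Cons split: nat.split)
  qed
  then show ?thesis
    using assms(1) by (auto simp: ordered_prod_def intro!: arg_cong[of _ _ prod_list])
qed

text \<open>In each partition exactly one block contains the given position, so each product of
  moments is linear in that entry, and a central \<open>c d\<close> leaves its block as the factor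
  \<open>h d\<close>. The Moebius weights do not depend on the entries.\<close>

lemma cumulant_multilinear:
  fixes F :: "'b::ring_1 \<Rightarrow> 'c::comm_ring_1" and c y :: "'d \<Rightarrow> 'b"
  assumes add: "\<And>x x'. F (x + x') = F x + F x'"
    and central: "\<And>d x. c d * x = x * c d"
    and F_c: "\<And>d x. F (c d * x) = h d * F x"
  shows "cumulant F (xs @ (\<Sum>d\<in>D. c d * y d) # ys)
    = (\<Sum>d\<in>D. h d * cumulant F (xs @ y d # ys))"
proof -
  let ?n = "length xs + Suc (length ys)" and ?p = "Suc (length xs)"
  let ?L = "\<lambda>x. xs @ x # ys"
  have F0: "F 0 = 0"
    using add[of 0 0] by simp
  have F_sum: "F (sum f D) = (\<Sum>d\<in>D. F (f d))" for f :: "'d \<Rightarrow> 'b"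
    by (induction D rule: infinite_finite_induct) (simp_all add: F0 add)
  have moment: "(\<Prod>V\<in>\<pi>. F (ordered_prod (?L (\<Sum>d\<in>D. c d * y d)) V))
      = (\<Sum>d\<in>D. h d * (\<Prod>V\<in>\<pi>. F (ordered_prod (?L (y d)) V)))" if "\<pi> \<in> NC ?n" for \<pi>
  proof -
    have \<pi>: "partition_on {1..?n} \<pi>"
      using that by (simp add: NC_def)
    have fin: "finite \<pi>"
      using \<pi> finite_elements by blast
    have V: "finite V" "0 \<notin> V" if "V \<in> \<pi>" for V
    proof -
      have "V \<subseteq> {1..?n}"
        using partition_onD1[OF \<pi>] that by blast
      then show "finite V" "0 \<notin> V"
        by (auto intro: finite_subset)
    qed
    have "?p \<in> \<Union>\<pi>"
      using partition_onD1[OF \<pi>] by auto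
    then obtain W where W: "W \<in> \<pi>" "?p \<in> W"
      by blast
    have other: "?p \<notin> V" if "V \<in> \<pi> - {W}" for V
      using partition_onD2[OF \<pi>] W that by (auto simp: disjoint_def)
    \<comment> \<open>The blocks other than \<open>W\<close> miss position \<open>?p\<close>, so the
      entry there may be replaced by the default 0.\<close>
    define R where "R = (\<Prod>V\<in>\<pi> - {W}. F (ordered_prod (?L 0) V))"
    have split: "(\<Prod>V\<in>\<pi>. F (ordered_prod (?L x) V)) = F (ordered_prod (?L x) W) * R" for x
    proof -
      have "(\<Prod>V\<in>\<pi> - {W}. F (ordered_prod (?L x) V)) = R"
        unfolding R_def using V other
        by (intro prod.cong refl arg_cong[of _ _ F] ordered_prod_other_position) auto
      then show ?thesis
        using prod.remove[OF fin W(1)] by metis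
    qed
    obtain u v where uv: "\<And>x. ordered_prod (?L x) W = u * x * v"
      using ordered_prod_insert_position[OF V(1)[OF W(1)] W(2) V(2)[OF W(1)]] by blast
    have "u * (c d * y d) * v = c d * (u * y d * v)" for d
      by (metis central mult.assoc)
    then have "F (u * (\<Sum>d\<in>D. c d * y d) * v) = (\<Sum>d\<in>D. h d * F (u * y d * v))"
      by (simp add: sum_distrib_left sum_distrib_right F_sum F_c)
    then show ?thesis
      by (simp add: split uv sum_distrib_right mult.assoc)
  qed
  show ?thesis
    unfolding cumulant_def
    by (simp add: moment sum_distrib_left sum_distrib_right mult.assoc sum.swap[of _ D])
qed

section \<open>Cumulants under homomorphisms\<close>

text \<open>A cumulant is a polynomial in moments with integer coefficients. The multiplicative
  \<open>H\<close> commutes with the ordered products, and the unital ring homomorphism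
  \<open>h\<close> with the polynomial.\<close>

lemma cumulant_hom:
  fixes H :: "'a::monoid_mult \<Rightarrow> 'b::monoid_mult" and h :: "'c::comm_ring_1 \<Rightarrow> 'd::comm_ring_1"
  assumes H: "H 1 = 1" "\<And>x y. H (x * y) = H x * H y"
    and h: "h 1 = 1" "\<And>x y. h (x * y) = h x * h y" "\<And>x y. h (x + y) = h x + h y"
    and F: "\<And>x. F (H x) = h (G x)"
  shows "cumulant F (map H xs) = h (cumulant G xs)"
proof -
  have h0: "h 0 = 0"
    using h(3)[of 0 0] by simp
  have hm: "h (- x) = - h x" for x
    using h(3)[of x "- x"] h0 by (simp add: eq_neg_iff_add_eq_0 add.commute)
  have h_nat: "h (of_nat m) = of_nat m" for m
    by (induction m) (simp_all add: h0 h)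
  \<comment> \<open>This makes \<open>h\<close> fix the Moebius values, which may be
    negative.\<close>
  have h_int: "h (of_int m) = of_int m" for m
    by (cases m) (simp_all add: h_nat hm h flip: of_nat_Suc)
  have h_prod: "h (prod f D) = (\<Prod>d\<in>D. h (f d))" for f and D :: "nat set set"
    by (induction D rule: infinite_finite_induct) (simp_all add: h)
  have h_sum: "h (sum f D) = (\<Sum>d\<in>D. h (f d))" for f and D :: "nat set set set"
    by (induction D rule: infinite_finite_induct) (simp_all add: h h0)
  have H_list: "prod_list (map H zs) = H (prod_list zs)" for zs
    by (induction zs) (simp_all add: H)
  have op: "ordered_prod (map H xs) V = H (ordered_prod xs V)" if "V \<subseteq> {1..length xs}" for V
  proof -
    have "finite V"
      using that finite_subset by blast
    then have "map (\<lambda>v. map H xs ! (v - 1)) (sorted_list_of_set V)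
        = map H (map (\<lambda>v. xs ! (v - 1)) (sorted_list_of_set V))"
      using that by (auto intro!: nth_map simp: subset_iff Suc_le_eq less_Suc_eq_le)
    then show ?thesis
      unfolding ordered_prod_def by (simp only: H_list)
  qed
  have "(\<Prod>V\<in>\<pi>. F (ordered_prod (map H xs) V)) = (\<Prod>V\<in>\<pi>. h (G (ordered_prod xs V)))"
    if "\<pi> \<in> NC (length xs)" for \<pi>
  proof (rule prod.cong[OF refl])
    fix V assume "V \<in> \<pi>"
    then have "V \<subseteq> {1..length xs}"
      using that partition_onD1 by (fastforce simp: NC_def)
    then show "F (ordered_prod (map H xs) V) = h (G (ordered_prod xs V))"
      by (simp add: op F)
  qed
  then show ?thesis
    unfolding cumulant_def by (simp add: h_sum h h_prod h_int)
qed

section \<open>Expansion of Toeplitz-valued cumulants along the formal sums\<close>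

lemma sum_mset_image_sum:
  "(\<Sum>t\<in>#sum M D. f t) = (\<Sum>d\<in>D. \<Sum>t\<in>#M d. f t :: 'c::comm_monoid_add)"
  by (induction D rule: infinite_finite_induct) simp_all

lemma sum_mset_sum_swap:
  "(\<Sum>t\<in>#M. \<Sum>d\<in>D. f t d) = (\<Sum>d\<in>D. \<Sum>t\<in>#M. f t d :: 'c::comm_monoid_add)"
  by (induction M) (simp_all add: sum.distrib)

text \<open>This is multiplication of truncated power series: exponents add, terms of degree at
  least \<open>CARD('n)\<close> vanish, and the others are grouped by degree. It yields the
  convolution in the recursion of \<open>Q\<close>.\<close>

lemma sum_monom_Cauchy_product:
  fixes g :: "nat \<Rightarrow> nat \<Rightarrow> ('a::ring_1, 'n::finite) toeplitz"
  shows "(\<Sum>k=1..CARD('n). \<Sum>l=1..CARD('n).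
      toeplitz_monom (k - 1) 1 * (toeplitz_monom (l - 1) 1 * g k l))
    = (\<Sum>j=1..CARD('n). toeplitz_monom (j - 1) 1 * (\<Sum>k=1..j. g k (j + 1 - k)))"
proof -
  let ?N = "CARD('n)" and ?t = "\<lambda>d. toeplitz_monom d 1 :: ('a, 'n) toeplitz"
  let ?P = "{1..?N} \<times> {1..?N}"
  have "(\<Sum>k=1..?N. \<Sum>l=1..?N. ?t (k - 1) * (?t (l - 1) * g k l))
      = (\<Sum>(k, l)\<in>?P. ?t (k + l - 2) * g k l)"
    by (simp add: sum.cartesian_product)
      (auto simp: toeplitz_monom_mult intro!: sum.cong simp flip: mult.assoc
        intro!: arg_cong2[of _ _ _ _ "(*)"] arg_cong2[of _ _ _ _ toeplitz_monom])
  also have "\<dots> = (\<Sum>(k, l)\<in>{p \<in> ?P. fst p + snd p \<le> ?N + 1}. ?t (k + l - 2) * g k l)"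
  proof (rule sum.mono_neutral_right)
    have "?t (k + l - 2) = 0" if "?N + 1 < k + l" for k l
      using that by (intro toeplitz_monom_eq_0) simp
    then show "\<forall>p\<in>?P - {p \<in> ?P. fst p + snd p \<le> ?N + 1}. (case p of (k, l) \<Rightarrow> ?t (k + l - 2) * g k l) = 0"
      by (simp add: split_beta not_le)
  qed auto
  \<comment> \<open>The new index is \<open>j = k + l - 1\<close>, so that
    \<open>l = j + 1 - k\<close>; the truncation \<open>k + l \<le> ?N + 1\<close> becomes
    \<open>j \<le> ?N\<close>.\<close>
  also have "\<dots> = (\<Sum>(j, k)\<in>(SIGMA j:{1..?N}. {1..j}). ?t (j - 1) * g k (j + 1 - k))"
    by (rule sum.reindex_bij_witness[of _ "\<lambda>(j, k). (k, j + 1 - k)" "\<lambda>(k, l). (k + l - 1, k)"])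
      (auto simp: numeral_2_eq_2)
  also have "\<dots> = (\<Sum>j=1..?N. ?t (j - 1) * (\<Sum>k=1..j. g k (j + 1 - k)))"
    by (simp add: sum.Sigma sum_distrib_left)
  finally show ?thesis .
qed

text \<open>The tail \<open>ys\<close> holds entries already expanded into constants. Keeping it
  arbitrary lets the induction handle the last Toeplitz entry first in the tail, matching
  \<open>Q\<close>, which appends on the right.\<close>

lemma cumulant_expansion:
  fixes A :: "nat \<Rightarrow> ('a::ring_1, 'n::finite) toeplitz"
  assumes add: "\<And>x y. \<phi> (x + y) = \<phi> x + \<phi> y" and "n \<ge> 1"
  shows "toeplitz_cumulant \<phi> (map (\<lambda>m. A (i m)) [1..<n + 1] @ ys)
    = (\<Sum>j=1..CARD('n). toeplitz_monom (j - 1) 1 *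
        (\<Sum>t\<in>#Q A i n j. toeplitz_cumulant \<phi> (map (toeplitz_monom 0) t @ ys)))"
proof -
  let ?E = "toeplitz_expectation \<phi> :: ('a, 'n) toeplitz \<Rightarrow> (complex, 'n) toeplitz"
  let ?N = "CARD('n)"
  let ?t = "\<lambda>d. toeplitz_monom d 1 :: (complex, 'n) toeplitz"
  let ?K = "\<lambda>t ys. cumulant ?E (map (toeplitz_monom 0) t @ ys)"
  have \<phi>0: "\<phi> 0 = 0"
    using add[of 0 0] by simp
  have expand: "cumulant ?E (xs @ X # ys)
      = (\<Sum>l=1..?N. ?t (l - 1) * cumulant ?E (xs @ toeplitz_monom 0 (entry X l) # ys))"
    for xs ys and X :: "('a, 'n) toeplitz"
  proof (subst (1) toeplitz_eq_sum_monom[of X], rule cumulant_multilinear)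
    show "?E (x + y) = ?E x + ?E y" for x y
      by (rule toeplitz_eqI) (simp add: toeplitz_expectation_def entry_tuple entry_plus add)
    show "toeplitz_monom (l - 1) 1 * x = x * toeplitz_monom (l - 1) 1" for l and x :: "('a, 'n) toeplitz"
      by (rule toeplitz_monom_1_commute)
    \<comment> \<open>Multiplication by a shift power only moves entries and fills with zeros, so it
      commutes with the entrywise \<open>\<phi>\<close>, given \<open>\<phi> 0 = 0\<close>.\<close>
    show "?E (toeplitz_monom (l - 1) 1 * x) = ?t (l - 1) * ?E x" for l x
      by (rule toeplitz_eqI)
        (auto simp: toeplitz_expectation_def entry_tuple entry_monom_times \<phi>0)
  qed
  show ?thesis
    using \<open>n \<ge> 1\<close>
  proof (induction n arbitrary: ys rule: nat_induct_at_least)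
    case base
    show ?case
      using expand[of "[]" "A (i 1)" ys] by simp
  next
    case (Suc n)
    \<comment> \<open>The recursive equation of \<open>Q\<close> applies only from length 2 on,
      because the value at 0 is a dummy.\<close>
    then obtain m where m: "n = Suc m"
      by (cases n) auto
    let ?a = "\<lambda>l. entry (A (i (Suc n))) l"
    have "cumulant ?E (map (\<lambda>m. A (i m)) [1..<Suc n + 1] @ ys)
        = cumulant ?E (map (\<lambda>m. A (i m)) [1..<n + 1] @ A (i (Suc n)) # ys)"
      by simp
    \<comment> \<open>The induction hypothesis is used with the unexpanded entry
      \<open>A (i (Suc n))\<close> at the head of the tail; \<open>expand\<close> then resolves that
      entry.\<close>
    also have "\<dots> = (\<Sum>k=1..?N. ?t (k - 1) * (\<Sum>t\<in>#Q A i n k. ?K t (A (i (Suc n)) # ys)))"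
      by (rule Suc.IH)
    also have "\<dots> = (\<Sum>k=1..?N. ?t (k - 1) * (\<Sum>t\<in>#Q A i n k.
        \<Sum>l=1..?N. ?t (l - 1) * ?K (t @ [?a l]) ys))"
      by (subst expand) simp
    also have "\<dots> = (\<Sum>k=1..?N. \<Sum>l=1..?N. ?t (k - 1) * (?t (l - 1) *
        (\<Sum>t\<in>#Q A i n k. ?K (t @ [?a l]) ys)))"
      by (simp add: sum_mset_sum_swap sum_distrib_left sum_mset_distrib_left)
    also have "\<dots> = (\<Sum>j=1..?N. ?t (j - 1) *
        (\<Sum>k=1..j. \<Sum>t\<in>#Q A i n k. ?K (t @ [?a (j + 1 - k)]) ys))"
      by (rule sum_monom_Cauchy_product)
    also have "\<dots> = (\<Sum>j=1..?N. ?t (j - 1) * (\<Sum>t\<in>#Q A i (Suc n) j. ?K t ys))"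
      by (simp add: m sum_mset_image_sum image_mset.compositionality comp_def)
    finally show ?case .
  qed
qed

theorem theorem2p1:
  fixes scale :: "complex \<Rightarrow> 'a::ring_1 \<Rightarrow> 'a" and \<phi> :: "'a \<Rightarrow> complex"
    and A :: "nat \<Rightarrow> ('a, 'n::finite) toeplitz"
    and s n :: nat and i :: "nat \<Rightarrow> nat"
  assumes "nc_prob_space scale \<phi>"
    and "s \<ge> 1" and "n \<ge> 1" and "i \<in> {1..n} \<rightarrow> {1..s}"
  shows "toeplitz_cumulant \<phi> (map (\<lambda>m. A (i m)) [1..<n + 1])
    = (tuple (\<lambda>j. formal_cumulant \<phi> (Q A i n j)) :: (complex, 'n) toeplitz)"
proof -
  let ?E = "toeplitz_expectation \<phi> :: ('a, 'n) toeplitz \<Rightarrow> (complex, 'n) toeplitz"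
  let ?c = "toeplitz_monom 0 :: complex \<Rightarrow> (complex, 'n) toeplitz"
  interpret nc_prob_space scale \<phi>
    by (rule assms(1))
  \<comment> \<open>Both \<open>H\<close> and \<open>h\<close> are embeddings of constants, over
    \<open>'a\<close> and over the complex numbers; on constants \<open>?E\<close> acts as
    \<open>\<phi>\<close>.\<close>
  have const: "cumulant ?E (map (toeplitz_monom 0) t) = ?c (scalar_cumulant \<phi> t)" for t
  proof (rule cumulant_hom)
    show "?E (toeplitz_monom 0 x) = ?c (\<phi> x)" for x
      by (rule toeplitz_eqI) (simp add: toeplitz_expectation_def entry_tuple entry_toeplitz_monom zero)
  qed (simp_all add: toeplitz_monom_0_1 toeplitz_monom_mult toeplitz_monom_add)
  have c0: "?c 0 = 0"
    by (rule toeplitz_eqI) (simp add: entry_toeplitz_monom entry_zero)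
  have c_sum: "(\<Sum>t\<in>#M. ?c (f t)) = ?c (\<Sum>t\<in>#M. f t)" for M :: "'a list multiset" and f
    by (induction M) (simp_all add: c0 toeplitz_monom_add)
  \<comment> \<open>With an empty tail the expansion involves only constant tuples, so each summand
    is an embedded scalar cumulant.\<close>
  have "cumulant ?E (map (\<lambda>m. A (i m)) [1..<n + 1])
      = (\<Sum>j=1..CARD('n). toeplitz_monom (j - 1) 1 *
          (\<Sum>t\<in>#Q A i n j. cumulant ?E (map (toeplitz_monom 0) t)))"
    using cumulant_expansion[of \<phi> n A i "[]"] assms(3) by (simp add: add)
  also have "\<dots> = (\<Sum>j=1..CARD('n). toeplitz_monom (j - 1) 1 * ?c (formal_cumulant \<phi> (Q A i n j)))"
    by (simp only: const c_sum formal_cumulant_def)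
  also have "\<dots> = tuple (\<lambda>j. formal_cumulant \<phi> (Q A i n j))"
    by (rule sum_monom_eq_tuple)
  finally show ?thesis .
qed

end
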